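(* Let $\Phi$ be an $n \times N$ complex matrix all of whose column vectors have Euclidean norm $1$. Let $m \geq 2$ be an integer and $\epsilon > 0$, and assume that $\Phi$ satisfies the restricted isometry property of order $m$ with parameter $\epsilon$. Then for every integer $k \geq m$, $\Phi$ satisfies the restricted isometry property of order $k$ with parameter $\delta = \epsilon (k-1)/(m-1)$.
   Context: A vector $x \in \mathbb{C}^N$ is $k$-sparse if it has at most $k$ nonzero coordinates. An $n \times N$ matrix $\Phi$ satisfies the restricted isometry property (RIP) of order $k$ with parameter $\delta$ if for every $k$-sparse vector $x \in \mathbb{C}^N$ one has $(1-\delta)\|x\|^2 \leq \|\Phi x\|^2 \leq (1+\delta)\|x\|^2$, where $\|\cdot\|$ is the Euclidean norm. *)

theory Defs
  imports "HOL-Analysis.Analysis"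
begin

definition sparse :: "nat \<Rightarrow> complex ^ 'N \<Rightarrow> bool" where
  "sparse k x \<longleftrightarrow> card {i. x $ i \<noteq> 0} \<le> k"

text \<open>
  The norm on \<^typ>\<open>complex ^ 'N\<close> is the Euclidean one. No bound such as \<open>\<delta> < 1\<close> is imposed.
\<close>

definition RIP :: "nat \<Rightarrow> real \<Rightarrow> complex ^ 'N ^ 'n \<Rightarrow> bool" where
  "RIP k \<delta> \<Phi> \<longleftrightarrow>
     (\<forall>x. sparse k x \<longrightarrow>
        (1 - \<delta>) * (norm x)\<^sup>2 \<le> (norm (\<Phi> *v x))\<^sup>2 \<and>
        (norm (\<Phi> *v x))\<^sup>2 \<le> (1 + \<delta>) * (norm x)\<^sup>2)"

end

(* The induction k to k+1 averages over deletions of a single coordinate. If the support S of x has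
   k+1 elements, then x and \<Phi> x are both sums over i in S of vectors v i (x i times a basis vector,
   respectively a unit column) with norm |x i|, and omitting one summand in turn gives
   sum_i |w - v i|^2 = (|S| - 2) |w|^2 + sum_i |v i|^2  for  w = sum_i v i.
   Restricted isometry for the k-sparse vectors x - v i then yields that for x, with \<delta> multiplied
   by k/(k-1); these factors telescope to (k-1)/(m-1). *)
theory Submission
  imports Defs
begin

text \<open>Expanding each square, the cross terms add up to -2 times the inner product of
  \<open>sum v S\<close> with itself. This accounts for the 2 subtracted from \<open>card S\<close>;
  no orthogonality of the \<open>v i\<close> is used.\<close>

lemma sum_norm_sum_diff_squared:
  fixes v :: "'a \<Rightarrow> 'b::real_inner"
  shows "(\<Sum>i\<in>S. (norm (sum v S - v i))\<^sup>2) =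
    (real (card S) - 2) * (norm (sum v S))\<^sup>2 + (\<Sum>i\<in>S. (norm (v i))\<^sup>2)"
proof -
  have "(\<Sum>i\<in>S. (norm (sum v S - v i))\<^sup>2)
      = (\<Sum>i\<in>S. (norm (sum v S))\<^sup>2 - 2 * inner (sum v S) (v i) + (norm (v i))\<^sup>2)"
    by (intro sum.cong refl) (simp add: power2_norm_eq_inner inner_diff inner_commute)
  also have "\<dots> = real (card S) * (norm (sum v S))\<^sup>2 - 2 * inner (sum v S) (sum v S)
      + (\<Sum>i\<in>S. (norm (v i))\<^sup>2)"
    by (simp add: sum.distrib sum_subtractf inner_sum_right sum_distrib_left)
  finally show ?thesis
    by (simp add: power2_norm_eq_inner algebra_simps)
qed

lemma norm_vector_scalar_mult:
  fixes v :: "'a::real_normed_div_algebra ^ 'n"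
  shows "norm (c *s v) = norm c * norm v"
  by (simp add: norm_vec_def norm_mult L2_set_right_distrib)

lemma norm_axis:
  fixes c :: "'a::real_normed_vector"
  shows "norm (axis i c) = norm c"
  by (simp add: norm_vec_def L2_set_def axis_def if_distrib[of norm] if_distrib[of "\<lambda>r. r\<^sup>2"]
      cong: if_cong)

lemma matrix_vector_mult_axis:
  fixes A :: "'a::comm_semiring_1 ^ 'n ^ 'm"
  shows "A *v axis j c = c *s column j A"
  by (simp add: vec_eq_iff matrix_vector_mult_def axis_def column_def mult.commute
      if_distrib cong: if_cong)

lemma RIP_mono:
  assumes "RIP k \<delta> \<Phi>" and "\<delta> \<le> \<delta>'"
  shows "RIP k \<delta>' \<Phi>"
  unfolding RIP_def
proof (intro allI impI)
  fix x :: "complex ^ 'a"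
  assume "sparse k x"
  then have "(1 - \<delta>) * (norm x)\<^sup>2 \<le> (norm (\<Phi> *v x))\<^sup>2"
    and "(norm (\<Phi> *v x))\<^sup>2 \<le> (1 + \<delta>) * (norm x)\<^sup>2"
    using assms(1) by (auto simp: RIP_def)
  moreover have "\<delta> * (norm x)\<^sup>2 \<le> \<delta>' * (norm x)\<^sup>2"
    using assms(2) by (intro mult_right_mono) auto
  ultimately show "(1 - \<delta>') * (norm x)\<^sup>2 \<le> (norm (\<Phi> *v x))\<^sup>2 \<and>
      (norm (\<Phi> *v x))\<^sup>2 \<le> (1 + \<delta>') * (norm x)\<^sup>2"
    by (simp add: algebra_simps)
qed

lemma RIP_Suc:
  fixes \<Phi> :: "complex ^ 'N ^ 'n"
  assumes unit_columns: "\<And>j. norm (column j \<Phi>) = 1"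
    and "k \<ge> 2" and "\<delta> \<ge> 0" and RIP: "RIP k \<delta> \<Phi>"
  shows "RIP (Suc k) (\<delta> * real k / (real k - 1)) \<Phi>" (is "RIP _ ?\<delta>' _")
  unfolding RIP_def
proof (intro allI impI)
  fix x :: "complex ^ 'N"
  assume sp: "sparse (Suc k) x"
  let ?goal = "(1 - ?\<delta>') * (norm x)\<^sup>2 \<le> (norm (\<Phi> *v x))\<^sup>2 \<and>
      (norm (\<Phi> *v x))\<^sup>2 \<le> (1 + ?\<delta>') * (norm x)\<^sup>2"
  define S where "S = {i. x $ i \<noteq> 0}"
  show ?goal
  proof (cases "sparse k x")
    case True
    \<comment> \<open>The averaging below counts on exactly \<open>Suc k\<close> nonzero
      coordinates. With fewer, the old bound is enough, because the factor k/(k-1) is at least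
      1.\<close>
    have "\<delta> \<le> ?\<delta>'"
      using \<open>k \<ge> 2\<close> \<open>\<delta> \<ge> 0\<close> by (simp add: field_simps)
    then show ?thesis
      using RIP_mono[OF RIP] True by (auto simp: RIP_def)
  next
    case False
    then have card: "card S = Suc k"
      using sp by (simp add: sparse_def S_def)
    define v where "v i = axis i (x $ i)" for i
    have x: "sum v S = x"
      by (auto simp: vec_eq_iff v_def axis_def S_def if_distrib cong: if_cong)
    have norm_v: "norm (v i) = cmod (x $ i)" for i
      by (simp add: v_def norm_axis)
    \<comment> \<open>This is where the unit columns enter: \<Phi> preserves the norm of each
      single-coordinate piece, so the squared norms of the pieces of \<Phi> x also add up to
      |x|^2.\<close>
    have norm_\<Phi>v: "norm (\<Phi> *v v i) = cmod (x $ i)" for i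
      by (simp add: v_def matrix_vector_mult_axis norm_vector_scalar_mult unit_columns)
    have norm_x: "(\<Sum>i\<in>S. (cmod (x $ i))\<^sup>2) = (norm x)\<^sup>2"
      unfolding norm_vec_def L2_set_def S_def
      by (subst real_sqrt_pow2) (auto intro!: sum_nonneg sum.mono_neutral_left)
    have \<Phi>x: "(\<Sum>i\<in>S. \<Phi> *v v i) = \<Phi> *v x"
      using linear_sum[OF matrix_vector_mul_linear, of \<Phi> v S] by (simp add: x)
    \<comment> \<open>Here \<open>card S - 2\<close> is k-1, and the squared norms of the pieces
      supply one more |x|^2. In the identity for \<Phi> x the two terms cannot merge, since |\<Phi>
      x| may differ from |x|.\<close>
    have sum_x: "(\<Sum>i\<in>S. (norm (x - v i))\<^sup>2) = real k * (norm x)\<^sup>2"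
      using sum_norm_sum_diff_squared[of v S]
      by (simp add: x card norm_v norm_x algebra_simps)
    have sum_\<Phi>x: "(\<Sum>i\<in>S. (norm (\<Phi> *v (x - v i)))\<^sup>2)
        = (real k - 1) * (norm (\<Phi> *v x))\<^sup>2 + (norm x)\<^sup>2"
      using sum_norm_sum_diff_squared[of "\<lambda>i. \<Phi> *v v i" S]
      by (simp add: \<Phi>x card norm_\<Phi>v norm_x matrix_vector_mult_diff_distrib)
    have "sparse k (x - v i)" if "i \<in> S" for i
    proof -
      have "{j. (x - v i) $ j \<noteq> 0} = S - {i}"
        by (auto simp: v_def axis_def S_def)
      then show ?thesis
        using that card by (simp add: sparse_def)
    qed
    then have lower: "(1 - \<delta>) * (norm (x - v i))\<^sup>2 \<le> (norm (\<Phi> *v (x - v i)))\<^sup>2"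
      and upper: "(norm (\<Phi> *v (x - v i)))\<^sup>2 \<le> (1 + \<delta>) * (norm (x - v i))\<^sup>2" if "i \<in> S" for i
      using RIP that by (auto simp: RIP_def)
    have "(1 - \<delta>) * (real k * (norm x)\<^sup>2) \<le> (real k - 1) * (norm (\<Phi> *v x))\<^sup>2 + (norm x)\<^sup>2"
      unfolding sum_x[symmetric] sum_\<Phi>x[symmetric] sum_distrib_left by (intro sum_mono lower)
    moreover have "(real k - 1) * (norm (\<Phi> *v x))\<^sup>2 + (norm x)\<^sup>2 \<le> (1 + \<delta>) * (real k * (norm x)\<^sup>2)"
      unfolding sum_x[symmetric] sum_\<Phi>x[symmetric] sum_distrib_left by (intro sum_mono upper)
    \<comment> \<open>Moving |x|^2 to the other side leaves (k-1) |\<Phi> x|^2 between (k-1 -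
      \<delta> k) |x|^2 and (k-1 + \<delta> k) |x|^2. Dividing by k-1 > 0 turns \<delta> into
      \<delta> k/(k-1).\<close>
    ultimately show ?thesis
      using \<open>k \<ge> 2\<close> by (simp add: field_simps)
  qed
qed

theorem theorem1:
  fixes \<Phi> :: "complex ^ 'N ^ 'n" and m :: nat and \<epsilon> :: real
  assumes unit_columns: "\<And>j. norm (column j \<Phi>) = 1"
    and "m \<ge> 2" and "\<epsilon> > 0"
    and "RIP m \<epsilon> \<Phi>"
  shows "\<forall>k\<ge>m. RIP k (\<epsilon> * (real k - 1) / (real m - 1)) \<Phi>"
proof (intro allI impI)
  fix k
  assume "m \<le> k"
  then show "RIP k (\<epsilon> * (real k - 1) / (real m - 1)) \<Phi>"
  proof (induction k rule: dec_induct)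
    case base
    then show ?case
      using assms by simp
  next
    case (step k)
    let ?\<delta> = "\<epsilon> * (real k - 1) / (real m - 1)"
    \<comment> \<open>The factor k-1 cancels, being nonzero by k \<ge> m \<ge> 2, and the remaining
      k is \<open>real (Suc k) - 1\<close>.\<close>
    have "?\<delta> * real k / (real k - 1) = \<epsilon> * (real (Suc k) - 1) / (real m - 1)"
      using step.hyps \<open>m \<ge> 2\<close> by simp
    moreover have "RIP (Suc k) (?\<delta> * real k / (real k - 1)) \<Phi>"
      using step assms by (intro RIP_Suc) auto
    ultimately show ?case
      by simp
  qed
qed

end
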